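(* Let $N$ be a finite set. For $\alpha \le \beta \in \mathcal{A}_N$, the size of the interval $[\alpha,\beta]$ is given by $$|[\alpha,\beta]| = \sum_{\chi_0 \subseteq \lambda_{l_0}}\ \sum_{\chi_2 \subseteq \chi_0^{++}}\ \sum_{\chi_4 \subseteq \chi_2^{++}} \cdots\ 2^{|\chi_0^{+}| - |\chi_2^-| + |\chi_2^+| - |\chi_4^-| + \cdots}$$ and also by $$|[\alpha,\beta]| = \sum_{\chi_1 \subseteq \lambda_{l_1}}\ \sum_{\chi_3 \subseteq \chi_1^{++}}\ \sum_{\chi_5 \subseteq \chi_3^{++}} \cdots\ 2^{|\lambda_{l_0}| - |\chi_1^{-}| + |\chi_1^{+}| - |\chi_3^-| + |\chi_3^+| - |\chi_5^-| + \cdots}.$$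
   Context: For a finite set $N$, $\mathcal{A}_N$ denotes the set of antichains in $N$: sets $\alpha \subseteq 2^N$ such that no two distinct members of $\alpha$ are in a subset/superset relationship. Order: $\alpha \le \beta$ iff for every $A \in \alpha$ there is $B \in \beta$ with $A \subseteq B$. Intervals: $[\alpha,\beta]=\{\chi \in \mathcal{A}_N : \alpha \le \chi \le \beta\}$. The poset underlying $[\alpha,\beta]$ (for $\alpha\le\beta$) is $\mathcal{P}_{[\alpha,\beta]}=\{X\subseteq N : \alpha<\alpha\vee\{X\}\le\beta\}$ ordered by inclusion, where $\alpha\vee\{X\}$ is the set of inclusion-maximal members of $\alpha\cup\{X\}$; equivalently $X\in\mathcal{P}_{[\alpha,\beta]}$ iff $\{X\}\le\beta$ and $\{X\}\not\le\alpha$. Let $l_0$ be the size of the smallest sets in $\mathcal{P}_{[\alpha,\beta]}$ (if $\alpha=\beta$ this poset is empty and $l_0$ may be taken to be any natural number), and $l_i=l_0+i$. For $l\in\mathbb{N}$, $\lambda_l=\{X\in\mathcal{P}_{[\alpha,\beta]} : |X|=l\}$. For a set $X$, $X^-=\{X\setminus\{x\}: x\in X\}$. For $\chi\subseteq\lambda_l$ (regarded as a subset of level $l$), $\chi^+=\{X\in\lambda_{l+1} : X^-\cap\lambda_l\subseteq\chi\}\subseteq\lambda_{l+1}$, $\chi^{++}=(\chi^+)^+\subseteq\lambda_{l+2}$, and, for $l>l_0$, $\chi^-=\bigcup_{X\in\chi}(X^-\cap\lambda_{l-1})\subseteq\lambda_{l-1}$. The set $\chi_i$ in the sums is always regarded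 as a subset of $\lambda_{l_i}$, also when it is empty (so $\chi_i^{+}$ and $\chi_i^-$ are computed with respect to level $l_i$). Since $\lambda_l=\emptyset$ for $l>|N|$, all but finitely many of the nested sums range only over $\emptyset$ and all but finitely many terms of the exponents are $0$. *)

theory Defs
  imports Complex_Main
begin

definition antichains :: "'a set \<Rightarrow> 'a set set set" where
  "antichains N = {\<alpha>. \<alpha> \<subseteq> Pow N \<and> (\<forall>A\<in>\<alpha>. \<forall>B\<in>\<alpha>. A \<subseteq> B \<longrightarrow> A = B)}"

definition ac_le :: "'a set set \<Rightarrow> 'a set set \<Rightarrow> bool" where
  "ac_le \<alpha> \<beta> \<longleftrightarrow> (\<forall>A\<in>\<alpha>. \<exists>B\<in>\<beta>. A \<subseteq> B)"

definition ac_less :: "'a set set \<Rightarrow> 'a set set \<Rightarrow> bool" where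
  "ac_less \<alpha> \<beta> \<longleftrightarrow> ac_le \<alpha> \<beta> \<and> \<alpha> \<noteq> \<beta>"

definition ac_interval :: "'a set \<Rightarrow> 'a set set \<Rightarrow> 'a set set \<Rightarrow> 'a set set set" where
  "ac_interval N \<alpha> \<beta> = {\<chi> \<in> antichains N. ac_le \<alpha> \<chi> \<and> ac_le \<chi> \<beta>}"

definition max_sets :: "'a set set \<Rightarrow> 'a set set" where
  "max_sets F = {A \<in> F. \<forall>B\<in>F. A \<subseteq> B \<longrightarrow> A = B}"

definition ac_join :: "'a set set \<Rightarrow> 'a set set \<Rightarrow> 'a set set" where
  "ac_join \<alpha> \<beta> = max_sets (\<alpha> \<union> \<beta>)"

definition ac_poset :: "'a set \<Rightarrow> 'a set set \<Rightarrow> 'a set set \<Rightarrow> 'a set set" where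
  "ac_poset N \<alpha> \<beta> = {X. X \<subseteq> N \<and> ac_less \<alpha> (ac_join \<alpha> {X}) \<and> ac_le (ac_join \<alpha> {X}) \<beta>}"

definition level :: "'a set \<Rightarrow> 'a set set \<Rightarrow> 'a set set \<Rightarrow> nat \<Rightarrow> 'a set set" where
  "level N \<alpha> \<beta> l = {X \<in> ac_poset N \<alpha> \<beta>. card X = l}"

definition shadow :: "'a set \<Rightarrow> 'a set set" where
  "shadow X = {X - {x} | x. x \<in> X}"

text \<open>
  The operations \<open>\<chi>\<^sup>+\<close>, \<open>\<chi>\<^sup>+\<^sup>+\<close> and \<open>\<chi>\<^sup>-\<close> depend on the level at which \<open>\<chi>\<close> is regarded as
  lying (which \<open>\<chi>\<close> does not determine when it is empty), so the level \<open>l\<close> of \<open>\<chi>\<close> is an explicit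
  argument. The operation \<open>down\<close> is only meant for levels \<open>l\<close> above the bottom level, in
  particular \<open>l > 0\<close>.
\<close>

definition up :: "'a set \<Rightarrow> 'a set set \<Rightarrow> 'a set set \<Rightarrow> nat \<Rightarrow> 'a set set \<Rightarrow> 'a set set" where
  "up N \<alpha> \<beta> l \<chi> = {X \<in> level N \<alpha> \<beta> (l + 1). shadow X \<inter> level N \<alpha> \<beta> l \<subseteq> \<chi>}"

definition upup :: "'a set \<Rightarrow> 'a set set \<Rightarrow> 'a set set \<Rightarrow> nat \<Rightarrow> 'a set set \<Rightarrow> 'a set set" where
  "upup N \<alpha> \<beta> l \<chi> = up N \<alpha> \<beta> (l + 1) (up N \<alpha> \<beta> l \<chi>)"

definition down :: "'a set \<Rightarrow> 'a set set \<Rightarrow> 'a set set \<Rightarrow> nat \<Rightarrow> 'a set set \<Rightarrow> 'a set set" where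
  "down N \<alpha> \<beta> l \<chi> = (\<Union>X\<in>\<chi>. shadow X \<inter> level N \<alpha> \<beta> (l - 1))"

text \<open>
  The index set of the infinitely nested sum
  \<open>\<Sum>\<chi>\<^sub>0 \<subseteq> level l. \<Sum>\<chi>\<^sub>1 \<subseteq> \<chi>\<^sub>0\<^sup>+\<^sup>+. \<Sum>\<chi>\<^sub>2 \<subseteq> \<chi>\<^sub>1\<^sup>+\<^sup>+. \<dots>\<close>: the sequences of
  admissible choices of the summation variables, where the \<open>k\<close>-th variable lies at level \<open>l + 2 * k\<close>.
  For finite \<open>N\<close> all levels above \<open>card N\<close> are empty, so every such sequence is eventually empty
  and there are only finitely many of them.
\<close>

definition nested_choices ::
  "'a set \<Rightarrow> 'a set set \<Rightarrow> 'a set set \<Rightarrow> nat \<Rightarrow> (nat \<Rightarrow> 'a set set) set" where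
  "nested_choices N \<alpha> \<beta> l =
     {\<chi>. \<chi> 0 \<subseteq> level N \<alpha> \<beta> l \<and> (\<forall>k. \<chi> (Suc k) \<subseteq> upup N \<alpha> \<beta> (l + 2 * k) (\<chi> k))}"

text \<open>
  The series \<open>\<bar>\<chi>\<^sub>0\<^sup>+\<bar> - \<bar>\<chi>\<^sub>1\<^sup>-\<bar> + \<bar>\<chi>\<^sub>1\<^sup>+\<bar> - \<bar>\<chi>\<^sub>2\<^sup>-\<bar> + \<dots>\<close> for such a sequence; for finite \<open>N\<close>
  it has only finitely many nonzero terms.
\<close>

definition alt_exponent ::
  "'a set \<Rightarrow> 'a set set \<Rightarrow> 'a set set \<Rightarrow> nat \<Rightarrow> (nat \<Rightarrow> 'a set set) \<Rightarrow> int" where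
  "alt_exponent N \<alpha> \<beta> l \<chi> =
     (\<Sum>k. int (card (up N \<alpha> \<beta> (l + 2 * k) (\<chi> k)))
         - int (card (down N \<alpha> \<beta> (l + 2 * Suc k) (\<chi> (Suc k)))))"

end

theory Submission imports Defs "HOL-Library.FuncSet" begin

(* An element chi of [alpha, beta] corresponds to the lower set of the sets of the underlying poset
   that lie below chi. Cutting a lower set into its levels E_0, E_1, ... turns it into a sequence
   with E_(i+1) a subset of E_i^+. Fix the levels of one parity: a level O in between is only
   constrained by chi_(k+1)^- <= O <= chi_k^+. Such an O exists iff chi_(k+1) <= chi_k^(++), there
   are 2^(|chi_k^+| - |chi_(k+1)^-|) of them, and the choices are independent of each other. *)

section \<open>Counting intervals of subsets and sequences of independent choices\<close>

lemma card_subset_interval: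
  assumes "finite B" "A \<subseteq> B"
  shows "card {C. A \<subseteq> C \<and> C \<subseteq> B} = 2 ^ (card B - card A)"
proof -
  have "bij_betw (\<lambda>C. C \<union> A) (Pow (B - A)) {C. A \<subseteq> C \<and> C \<subseteq> B}"
    by (rule bij_betwI[where g = "\<lambda>C. C - A"]) (use assms in auto)
  then have "card {C. A \<subseteq> C \<and> C \<subseteq> B} = card (Pow (B - A))"
    by (simp add: bij_betw_same_card)
  then show ?thesis
    using assms by (simp add: card_Pow card_Diff_subset finite_subset)
qed

text \<open>From index \<open>K\<close> on there is only one choice, so an infinite sequence carries
  no more information than its first \<open>K\<close> terms. This turns the infinite families of
  levels into a finite product.\<close>

lemma
  fixes F :: "nat \<Rightarrow> 'b set"
  assumes fin: "\<And>k. finite (F k)" and triv: "\<And>k. k \<ge> K \<Longrightarrow> F k = {c}"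
  shows finite_choice_funs: "finite {f. \<forall>k. f k \<in> F k}"
    and card_choice_funs: "card {f. \<forall>k. f k \<in> F k} = (\<Prod>k<K. card (F k))"
proof -
  \<comment> \<open>Functions in \<open>PiE\<close> are \<open>undefined\<close> from
    \<open>K\<close> on; the forward map overwrites this tail with the forced value
    \<open>c\<close>, and \<open>restrict\<close> undoes it.\<close>
  have bij: "bij_betw (\<lambda>f k. if k < K then f k else c) (PiE {..<K} F) {f. \<forall>k. f k \<in> F k}"
  proof (rule bij_betwI[where g = "\<lambda>f. restrict f {..<K}"])
    show "(\<lambda>f k. if k < K then f k else c) \<in> PiE {..<K} F \<rightarrow> {f. \<forall>k. f k \<in> F k}"
      using triv by (auto simp: PiE_def Pi_def)
    show "(\<lambda>f. restrict f {..<K}) \<in> {f. \<forall>k. f k \<in> F k} \<rightarrow> PiE {..<K} F"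
      by auto
    show "restrict (\<lambda>k. if k < K then f k else c) {..<K} = f" if "f \<in> PiE {..<K} F" for f
      using that by (auto simp: fun_eq_iff PiE_def extensional_def)
    show "(\<lambda>k. if k < K then restrict f {..<K} k else c) = f"
      if "f \<in> {f. \<forall>k. f k \<in> F k}" for f
    proof -
      have "f k = c" if "\<not> k < K" for k
        using triv[of k] that \<open>f \<in> _\<close> by force
      then show ?thesis by auto
    qed
  qed
  have "finite (PiE {..<K} F)"
    using fin by (intro finite_PiE) auto
  with bij show "finite {f. \<forall>k. f k \<in> F k}"
    using bij_betw_finite by blast
  from bij have "card {f. \<forall>k. f k \<in> F k} = card (PiE {..<K} F)"
    using bij_betw_same_card by fastforce
  then show "card {f. \<forall>k. f k \<in> F k} = (\<Prod>k<K. card (F k))"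
    by (simp add: card_PiE)
qed

section \<open>Maximal sets and membership in the underlying poset\<close>

lemma max_sets_above:
  assumes "finite F" "X \<in> F"
  obtains M where "M \<in> max_sets F" "X \<subseteq> M"
proof -
  from finite_has_maximal2[OF assms] obtain M
    where "M \<in> F" "X \<subseteq> M" "\<forall>B\<in>F. M \<subseteq> B \<longrightarrow> M = B" by blast
  then show thesis
    using that by (auto simp: max_sets_def)
qed

lemma max_sets_antichain:
  assumes "F \<subseteq> Pow N"
  shows "max_sets F \<in> antichains N"
proof -
  have "max_sets F \<subseteq> F"
    by (simp add: max_sets_def)
  with assms have "max_sets F \<subseteq> Pow N"
    by (rule order_trans[rotated])
  then show ?thesis
    by (simp add: antichains_def max_sets_def)
qed

text \<open>By finiteness every member of \<alpha> lies below a maximal set, so \<alpha> is always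
  below the join, and strictness only asks that the join differ from \<alpha>. It differs precisely
  when \<open>X\<close> is not absorbed by a member of \<alpha>.\<close>

lemma ac_poset_iff:
  assumes "finite N" "\<alpha> \<in> antichains N" "ac_le \<alpha> \<beta>"
  shows "X \<in> ac_poset N \<alpha> \<beta> \<longleftrightarrow> X \<subseteq> N \<and> (\<exists>B\<in>\<beta>. X \<subseteq> B) \<and> \<not> (\<exists>A\<in>\<alpha>. X \<subseteq> A)"
proof -
  have "finite \<alpha>"
    using assms(1,2) by (auto simp: antichains_def intro: finite_subset)
  then have fin: "finite (\<alpha> \<union> {X})" by simp
  have ge: "ac_le \<alpha> (ac_join \<alpha> {X})"
    unfolding ac_le_def ac_join_def using max_sets_above[OF fin] by (metis UnI1)
  have "ac_le (ac_join \<alpha> {X}) \<beta> \<longleftrightarrow> (\<exists>B\<in>\<beta>. X \<subseteq> B)"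
  proof
    assume le: "ac_le (ac_join \<alpha> {X}) \<beta>"
    obtain M where "M \<in> ac_join \<alpha> {X}" "X \<subseteq> M"
      using max_sets_above[OF fin, of X] by (auto simp: ac_join_def)
    then show "\<exists>B\<in>\<beta>. X \<subseteq> B"
      using le unfolding ac_le_def by (meson order_trans)
  next
    assume "\<exists>B\<in>\<beta>. X \<subseteq> B"
    then show "ac_le (ac_join \<alpha> {X}) \<beta>"
      using assms(3) by (auto simp: ac_le_def ac_join_def max_sets_def)
  qed
  moreover have "\<alpha> \<noteq> ac_join \<alpha> {X} \<longleftrightarrow> \<not> (\<exists>A\<in>\<alpha>. X \<subseteq> A)"
  proof
    assume ne: "\<alpha> \<noteq> ac_join \<alpha> {X}"
    show "\<not> (\<exists>A\<in>\<alpha>. X \<subseteq> A)"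
    proof
      assume "\<exists>A\<in>\<alpha>. X \<subseteq> A"
      then obtain A where A: "A \<in> \<alpha>" "X \<subseteq> A" by blast
      have eq: "B = C" if "B \<in> \<alpha>" "C \<in> \<alpha>" "B \<subseteq> C" for B C
        using assms(2) that by (auto simp: antichains_def)
      \<comment> \<open>Here \<open>C \<subseteq> X \<subseteq> A\<close> with \<open>C\<close> and
        \<open>A\<close> in the antichain \<alpha> forces all three to be equal. So \<open>X\<close>
        makes no member of \<alpha> non-maximal.\<close>
      have "C = X" if C: "C \<in> \<alpha>" "C \<subseteq> X" for C
        using eq[OF C(1) A(1)] C(2) A(2) by (metis order_trans subset_antisym)
      then have "C \<in> ac_join \<alpha> {X}" if "C \<in> \<alpha>" for C
        using that eq by (simp add: ac_join_def max_sets_def)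
      moreover have "C \<in> \<alpha>" if "C \<in> ac_join \<alpha> {X}" for C
        using that A by (auto simp: ac_join_def max_sets_def)
      ultimately show False using ne by (metis subsetI subset_antisym)
    qed
  next
    assume nle: "\<not> (\<exists>A\<in>\<alpha>. X \<subseteq> A)"
    then have "X \<in> ac_join \<alpha> {X}" "X \<notin> \<alpha>"
      by (auto simp: ac_join_def max_sets_def)
    then show "\<alpha> \<noteq> ac_join \<alpha> {X}" by blast
  qed
  ultimately show ?thesis
    using ge by (auto simp: ac_poset_def ac_less_def)
qed

section \<open>From antichain intervals to lower sets of the poset\<close>

definition lower_sets :: "'a set set \<Rightarrow> 'a set set set" where
  "lower_sets P = {D. D \<subseteq> P \<and> (\<forall>Y\<in>D. \<forall>X\<in>P. X \<subseteq> Y \<longrightarrow> X \<in> D)}"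

text \<open>An antichain is determined by the sets below it. For an antichain above \<alpha>,
  everything below \<alpha> is among these automatically, so only the part inside the poset carries
  information; the inverse map puts \<alpha> back before taking maximal sets.\<close>

lemma card_ac_interval_eq_lower_sets:
  assumes "finite N" "\<alpha> \<in> antichains N" "\<beta> \<in> antichains N" "ac_le \<alpha> \<beta>"
  shows "card (ac_interval N \<alpha> \<beta>) = card (lower_sets (ac_poset N \<alpha> \<beta>))"
proof -
  define P where "P = ac_poset N \<alpha> \<beta>"
  have P: "X \<in> P \<longleftrightarrow> X \<subseteq> N \<and> (\<exists>B\<in>\<beta>. X \<subseteq> B) \<and> \<not> (\<exists>A\<in>\<alpha>. X \<subseteq> A)" for X
    unfolding P_def by (rule ac_poset_iff[OF assms(1,2,4)])
  have \<alpha>N: "\<alpha> \<subseteq> Pow N"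
    using assms(2) by (simp add: antichains_def)
  have bij: "bij_betw (\<lambda>\<chi>. {X \<in> P. \<exists>C\<in>\<chi>. X \<subseteq> C}) (ac_interval N \<alpha> \<beta>) (lower_sets P)"
  proof (rule bij_betwI[where g = "\<lambda>D. max_sets (\<alpha> \<union> D)"])
    show "(\<lambda>\<chi>. {X \<in> P. \<exists>C\<in>\<chi>. X \<subseteq> C}) \<in> ac_interval N \<alpha> \<beta> \<rightarrow> lower_sets P"
      unfolding lower_sets_def by blast
  next
    show "(\<lambda>D. max_sets (\<alpha> \<union> D)) \<in> lower_sets P \<rightarrow> ac_interval N \<alpha> \<beta>"
    proof
      fix D assume "D \<in> lower_sets P"
      then have D: "D \<subseteq> P" by (simp add: lower_sets_def)
      have sub: "\<alpha> \<union> D \<subseteq> Pow N"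
        using D \<alpha>N by (auto simp: P_def ac_poset_def)
      then have fin: "finite (\<alpha> \<union> D)"
        using assms(1) finite_subset by blast
      have "ac_le \<alpha> (max_sets (\<alpha> \<union> D))"
        unfolding ac_le_def using max_sets_above[OF fin] by (metis UnI1)
      moreover have "ac_le (max_sets (\<alpha> \<union> D)) \<beta>"
        unfolding ac_le_def
      proof
        fix A assume "A \<in> max_sets (\<alpha> \<union> D)"
        then have "A \<in> \<alpha> \<or> A \<in> P"
          using D by (auto simp: max_sets_def)
        then show "\<exists>B\<in>\<beta>. A \<subseteq> B"
          using assms(4) by (auto simp: P ac_le_def)
      qed
      ultimately show "max_sets (\<alpha> \<union> D) \<in> ac_interval N \<alpha> \<beta>"
        using max_sets_antichain[OF sub] by (simp add: ac_interval_def)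
    qed
  next
    fix \<chi> assume "\<chi> \<in> ac_interval N \<alpha> \<beta>"
    then have \<chi>: "\<chi> \<subseteq> Pow N" "ac_le \<alpha> \<chi>" "ac_le \<chi> \<beta>"
      and eq: "\<And>A B. A \<in> \<chi> \<Longrightarrow> B \<in> \<chi> \<Longrightarrow> A \<subseteq> B \<Longrightarrow> A = B"
      by (auto simp: ac_interval_def antichains_def)
    define D where "D = {X \<in> P. \<exists>C\<in>\<chi>. X \<subseteq> C}"
    have below: "\<exists>C\<in>\<chi>. X \<subseteq> C" if "X \<in> \<alpha> \<union> D" for X
      using that \<chi>(2) by (auto simp: D_def ac_le_def)
    \<comment> \<open>If \<open>C\<close> is below some \<open>A\<close> in \<alpha>, then
      \<open>A\<close> is in turn below some \<open>C'\<close> in \<chi>, and the antichain property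
      of \<chi> collapses \<open>C \<subseteq> A \<subseteq> C'\<close> to equality. Otherwise
      \<open>C\<close> belongs to the poset.\<close>
    have mem: "C \<in> \<alpha> \<union> D" if C: "C \<in> \<chi>" for C
    proof (cases "\<exists>A\<in>\<alpha>. C \<subseteq> A")
      case True
      then obtain A where A: "A \<in> \<alpha>" "C \<subseteq> A" by blast
      then obtain C' where "C' \<in> \<chi>" "A \<subseteq> C'"
        using \<chi>(2) by (auto simp: ac_le_def)
      then have "C = A"
        using eq[OF C, of C'] A by (metis order_trans subset_antisym)
      then show ?thesis using A by simp
    next
      case False
      then have "C \<in> P"
        using C \<chi>(1,3) by (auto simp: P ac_le_def)
      then show ?thesis using C by (auto simp: D_def)
    qed
    have "max_sets (\<alpha> \<union> D) \<subseteq> \<chi>"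
    proof
      fix X assume X: "X \<in> max_sets (\<alpha> \<union> D)"
      then obtain C where "C \<in> \<chi>" "X \<subseteq> C"
        using below[of X] by (auto simp: max_sets_def)
      then show "X \<in> \<chi>"
        using X mem[of C] by (auto simp: max_sets_def)
    qed
    moreover have "\<chi> \<subseteq> max_sets (\<alpha> \<union> D)"
    proof
      fix C assume C: "C \<in> \<chi>"
      \<comment> \<open>\<open>X\<close> lies below some member of \<chi>, which then contains
        \<open>C\<close> and so equals it.\<close>
      have "C = X" if "X \<in> \<alpha> \<union> D" "C \<subseteq> X" for X
        using below[OF that(1)] that(2) eq[OF C] by (metis order_trans subset_antisym)
      then show "C \<in> max_sets (\<alpha> \<union> D)"
        using mem[OF C] by (simp add: max_sets_def)
    qed
    ultimately show "max_sets (\<alpha> \<union> {X \<in> P. \<exists>C\<in>\<chi>. X \<subseteq> C}) = \<chi>"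
      by (simp add: D_def)
  next
    fix D assume "D \<in> lower_sets P"
    then have D: "D \<subseteq> P" and low: "\<And>X Y. Y \<in> D \<Longrightarrow> X \<in> P \<Longrightarrow> X \<subseteq> Y \<Longrightarrow> X \<in> D"
      by (auto simp: lower_sets_def)
    have "D \<subseteq> Pow N"
      using D by (auto simp: P_def ac_poset_def)
    then have "finite (\<alpha> \<union> D)"
      using \<alpha>N assms(1) by (meson Un_least finite_Pow_iff finite_subset)
    note above = max_sets_above[OF this]
    show "{X \<in> P. \<exists>C\<in>max_sets (\<alpha> \<union> D). X \<subseteq> C} = D"
    proof (intro equalityI subsetI)
      fix X assume "X \<in> {X \<in> P. \<exists>C\<in>max_sets (\<alpha> \<union> D). X \<subseteq> C}"
      then obtain C where C: "X \<in> P" "C \<in> \<alpha> \<union> D" "X \<subseteq> C"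
        by (auto simp: max_sets_def)
      \<comment> \<open>\<open>C\<close> cannot come from \<alpha>, since a set of the poset lies
        below no member of \<alpha>.\<close>
      then have "C \<in> D" by (auto simp: P)
      then show "X \<in> D" using C low by simp
    next
      fix X assume X: "X \<in> D"
      then obtain M where "M \<in> max_sets (\<alpha> \<union> D)" "X \<subseteq> M"
        using above[of X] by auto
      then show "X \<in> {X \<in> P. \<exists>C\<in>max_sets (\<alpha> \<union> D). X \<subseteq> C}"
        using X D by auto
    qed
  qed
  then show ?thesis
    unfolding P_def by (rule bij_betw_same_card)
qed

section \<open>Chains of levels, and the operations \<open>up\<close> and
  \<open>down\<close>\<close>

text \<open>A lower set encoded by its slices, \<open>E i\<close> being the slice at level
  \<open>l + i\<close>. Only neighbouring slices constrain each other, which is what later decouples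
  the levels of one parity.\<close>

definition level_chains :: "'a set \<Rightarrow> 'a set set \<Rightarrow> 'a set set \<Rightarrow> nat \<Rightarrow> (nat \<Rightarrow> 'a set set) set" where
  "level_chains N \<alpha> \<beta> l =
     {E. E 0 \<subseteq> level N \<alpha> \<beta> l \<and> (\<forall>i. E (Suc i) \<subseteq> up N \<alpha> \<beta> (l + i) (E i))}"

lemma level_subset_Pow: "level N \<alpha> \<beta> l \<subseteq> Pow N"
  by (auto simp: level_def ac_poset_def)

lemma finite_level: "finite N \<Longrightarrow> finite (level N \<alpha> \<beta> l)"
  using level_subset_Pow by (metis finite_Pow_iff finite_subset)

lemma level_eq_empty:
  assumes "finite N" "card N < l"
  shows "level N \<alpha> \<beta> l = {}"
proof -
  have "card X \<noteq> l" if "X \<subseteq> N" for X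
    using card_mono[OF assms(1) that] assms(2) by simp
  then show ?thesis
    by (simp add: level_def ac_poset_def)
qed

lemma up_subset_level: "up N \<alpha> \<beta> l \<chi> \<subseteq> level N \<alpha> \<beta> (Suc l)"
  by (auto simp: up_def)

lemma up_mono: "\<chi> \<subseteq> \<chi>' \<Longrightarrow> up N \<alpha> \<beta> l \<chi> \<subseteq> up N \<alpha> \<beta> l \<chi>'"
  by (auto simp: up_def)

lemma down_subset_level: "down N \<alpha> \<beta> (Suc l) \<chi> \<subseteq> level N \<alpha> \<beta> l"
  by (auto simp: down_def)

text \<open>A Galois connection: \<open>down\<close> is the lower adjoint of \<open>up\<close>. It
  converts the condition that a level imposes on the next one into a lower bound for the level
  beneath. Writing the upper level as \<open>Suc l\<close> keeps the \<open>l - 1\<close> inside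
  \<open>down\<close> exact.\<close>

lemma subset_up_iff:
  assumes "\<chi> \<subseteq> level N \<alpha> \<beta> (Suc l)"
  shows "\<chi> \<subseteq> up N \<alpha> \<beta> l \<psi> \<longleftrightarrow> down N \<alpha> \<beta> (Suc l) \<chi> \<subseteq> \<psi>"
proof -
  have "\<chi> \<subseteq> up N \<alpha> \<beta> l \<psi> \<longleftrightarrow> (\<forall>X\<in>\<chi>. shadow X \<inter> level N \<alpha> \<beta> l \<subseteq> \<psi>)"
    using assms unfolding up_def by auto
  then show ?thesis
    by (auto simp: down_def)
qed

lemma level_chains_subset_level:
  assumes "E \<in> level_chains N \<alpha> \<beta> l"
  shows "E i \<subseteq> level N \<alpha> \<beta> (l + i)"
proof (cases i)
  case 0
  then show ?thesis using assms by (simp add: level_chains_def)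
next
  case (Suc j)
  then have "E i \<subseteq> up N \<alpha> \<beta> (l + j) (E j)"
    using assms by (simp add: level_chains_def)
  then show ?thesis
    using up_subset_level[of N \<alpha> \<beta> "l + j" "E j"] by (simp add: Suc)
qed

lemma nested_choices_subset_level:
  assumes "\<chi> \<in> nested_choices N \<alpha> \<beta> l"
  shows "\<chi> k \<subseteq> level N \<alpha> \<beta> (l + 2 * k)"
proof (cases k)
  case 0
  then show ?thesis using assms by (simp add: nested_choices_def)
next
  case (Suc m)
  then have "\<chi> k \<subseteq> upup N \<alpha> \<beta> (l + 2 * m) (\<chi> m)"
    using assms by (simp add: nested_choices_def)
  also have "\<dots> \<subseteq> level N \<alpha> \<beta> (l + 2 * k)"
    using up_subset_level[of N \<alpha> \<beta> "Suc (l + 2 * m)"] by (simp add: upup_def Suc)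
  finally show ?thesis .
qed

text \<open>Once \<open>k\<close> exceeds \<open>card N\<close>, so does \<open>\<nu> k\<close>, and
  the level there is empty. Taking \<open>\<nu>\<close> as \<open>l + i\<close> or
  \<open>l + 2 * k\<close> gives finiteness of both families of sequences that are summed
  over.\<close>

lemma finite_level_sequences:
  assumes "finite N" "\<And>k. \<nu> k \<ge> k"
  shows "finite {f. \<forall>k. f k \<subseteq> level N \<alpha> \<beta> (\<nu> k)}"
proof -
  have "finite {f. \<forall>k. f k \<in> Pow (level N \<alpha> \<beta> (\<nu> k))}"
  proof (rule finite_choice_funs)
    show "finite (Pow (level N \<alpha> \<beta> (\<nu> k)))" for k
      using assms(1) by (simp add: finite_level)
    show "Pow (level N \<alpha> \<beta> (\<nu> k)) = {{}}" if "Suc (card N) \<le> k" for k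
      using that assms(2)[of k] level_eq_empty[OF assms(1), of "\<nu> k"] by simp
  qed
  then show ?thesis by simp
qed

lemma finite_level_chains: "finite N \<Longrightarrow> finite (level_chains N \<alpha> \<beta> l)"
  by (rule finite_subset[OF _ finite_level_sequences[of N "\<lambda>i. l + i" \<alpha> \<beta>]])
     (auto dest: subsetD[OF level_chains_subset_level])

lemma finite_nested_choices: "finite N \<Longrightarrow> finite (nested_choices N \<alpha> \<beta> l)"
  by (rule finite_subset[OF _ finite_level_sequences[of N "\<lambda>k. l + 2 * k" \<alpha> \<beta>]])
     (auto dest: subsetD[OF nested_choices_subset_level])

section \<open>Lower sets of the poset as chains of levels\<close>

text \<open>A chain is closed downwards only one level at a time. This suffices because the poset is
  convex: any inclusion inside it can be descended by deleting single elements without leaving it.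
  By \<open>bot\<close>, the levels from \<open>l\<close> on exhaust the poset.\<close>

lemma card_lower_sets_eq_level_chains:
  assumes "finite N" "\<alpha> \<in> antichains N" "ac_le \<alpha> \<beta>"
    and bot: "\<And>X. X \<in> ac_poset N \<alpha> \<beta> \<Longrightarrow> l \<le> card X"
  shows "card (lower_sets (ac_poset N \<alpha> \<beta>)) = card (level_chains N \<alpha> \<beta> l)"
proof -
  define P where "P = ac_poset N \<alpha> \<beta>"
  have P: "X \<in> P \<longleftrightarrow> X \<subseteq> N \<and> (\<exists>B\<in>\<beta>. X \<subseteq> B) \<and> \<not> (\<exists>A\<in>\<alpha>. X \<subseteq> A)" for X
    unfolding P_def by (rule ac_poset_iff[OF assms(1-3)])
  have lev: "X \<in> level N \<alpha> \<beta> m \<longleftrightarrow> X \<in> P \<and> card X = m" for X m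
    by (auto simp: level_def P_def)
  have finX: "finite X" if "X \<in> P" for X
    using that assms(1) by (auto simp: P intro: finite_subset)
  have descend: "X \<in> E (card X - l)"
    if E: "E \<in> level_chains N \<alpha> \<beta> l" and "Y \<in> E i" "X \<in> P" "X \<subseteq> Y" for E X Y i
    using that(2-)
  proof (induction i arbitrary: Y)
    case (0 Y)
    then have Y: "Y \<in> P" "card Y = l"
      using level_chains_subset_level[OF E, of 0] lev by auto
    then have "X = Y"
      \<comment> \<open>At the bottom level \<open>Y\<close> has the least size allowed by
        \<open>bot\<close>, so a subset of it in the poset cannot be smaller.\<close>
      using bot[of X] 0 finX[of Y] by (metis P_def card_seteq)
    then show ?case using 0 Y by simp
  next
    case (Suc i Y)
    have Y: "Y \<in> P" "card Y = Suc (l + i)"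
      using level_chains_subset_level[OF E, of "Suc i"] Suc.prems(1) lev by auto
    show ?case
    proof (cases "X = Y")
      case True
      then show ?thesis using Suc.prems Y by simp
    next
      case False
      then obtain y where y: "y \<in> Y" "X \<subseteq> Y - {y}"
        using Suc.prems(3) by blast
      \<comment> \<open>Convexity: \<open>Y - {y}\<close> is below \<beta> because \<open>Y\<close>
        is, and not below \<alpha> because it contains \<open>X\<close>.\<close>
      then have "Y - {y} \<in> P"
        using Y(1) Suc.prems(2) unfolding P by (meson Diff_subset order_trans)
      then have "Y - {y} \<in> shadow Y \<inter> level N \<alpha> \<beta> (l + i)"
        using Y y(1) finX[of Y] lev by (auto simp: shadow_def)
      moreover have "Y \<in> up N \<alpha> \<beta> (l + i) (E i)"
        using E Suc.prems(1) by (auto simp: level_chains_def)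
      ultimately have "Y - {y} \<in> E i"
        by (auto simp: up_def)
      then show ?thesis
        using Suc.IH Suc.prems(2) y(2) by blast
    qed
  qed
  have bij: "bij_betw (\<lambda>D i. D \<inter> level N \<alpha> \<beta> (l + i)) (lower_sets P) (level_chains N \<alpha> \<beta> l)"
  proof (rule bij_betwI[where g = "\<lambda>E. \<Union>i. E i"])
    show "(\<lambda>D i. D \<inter> level N \<alpha> \<beta> (l + i)) \<in> lower_sets P \<rightarrow> level_chains N \<alpha> \<beta> l"
      by (auto simp: lower_sets_def level_chains_def up_def lev shadow_def)
    show "(\<lambda>E. \<Union>i. E i) \<in> level_chains N \<alpha> \<beta> l \<rightarrow> lower_sets P"
    proof
      fix E assume E: "E \<in> level_chains N \<alpha> \<beta> l"
      have "E i \<subseteq> P" for i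
        using level_chains_subset_level[OF E, of i] lev by auto
      then show "(\<Union>i. E i) \<in> lower_sets P"
        by (auto simp: lower_sets_def intro: descend[OF E])
    qed
    show "(\<Union>i. D \<inter> level N \<alpha> \<beta> (l + i)) = D" if D: "D \<in> lower_sets P" for D
    proof -
      \<comment> \<open>\<open>bot\<close> ensures that the subtraction of naturals is not
        truncated.\<close>
      have "X \<in> level N \<alpha> \<beta> (l + (card X - l))" if "X \<in> D" for X
        using that D bot[of X] by (auto simp: lev lower_sets_def P_def)
      then show ?thesis by blast
    qed
    show "(\<lambda>i. (\<Union>j. E j) \<inter> level N \<alpha> \<beta> (l + i)) = E" if E: "E \<in> level_chains N \<alpha> \<beta> l" for E
    proof
      fix i
      have sub: "E j \<subseteq> level N \<alpha> \<beta> (l + j)" for j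
        by (rule level_chains_subset_level[OF E])
      \<comment> \<open>Distinct levels are disjoint, so cutting the union at one level returns that
        slice alone.\<close>
      have "j = i" if "X \<in> E j" "X \<in> level N \<alpha> \<beta> (l + i)" for X j
        using that sub[of j] lev by auto
      then show "(\<Union>j. E j) \<inter> level N \<alpha> \<beta> (l + i) = E i"
        using sub[of i] by blast
    qed
  qed
  then show ?thesis
    unfolding P_def by (rule bij_betw_same_card)
qed

section \<open>Chains with prescribed even levels\<close>

lemma even_levels_nested_choices:
  assumes "E \<in> level_chains N \<alpha> \<beta> l"
  shows "(\<lambda>k. E (2 * k)) \<in> nested_choices N \<alpha> \<beta> l"
proof -
  have step: "E (Suc i) \<subseteq> up N \<alpha> \<beta> (l + i) (E i)" for i
    using assms by (simp add: level_chains_def)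
  have "E (2 * Suc k) \<subseteq> upup N \<alpha> \<beta> (l + 2 * k) (E (2 * k))" for k
    using step[of "Suc (2 * k)"] up_mono[OF step[of "2 * k"], of N \<alpha> \<beta> "Suc (l + 2 * k)"]
    by (auto simp: upup_def)
  then show ?thesis
    using assms by (auto simp: nested_choices_def level_chains_def)
qed

text \<open>Moving one of the two \<open>up\<close> operations across the adjunction. It guarantees
  that each odd level has a nonempty interval of choices and that each term of the exponent is
  nonnegative.\<close>

lemma down_subset_up:
  assumes "\<chi> \<in> nested_choices N \<alpha> \<beta> l"
  shows "down N \<alpha> \<beta> (l + 2 * Suc k) (\<chi> (Suc k)) \<subseteq> up N \<alpha> \<beta> (l + 2 * k) (\<chi> k)"
proof -
  have "\<chi> (Suc k) \<subseteq> up N \<alpha> \<beta> (Suc (l + 2 * k)) (up N \<alpha> \<beta> (l + 2 * k) (\<chi> k))"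
    using assms by (simp add: nested_choices_def upup_def)
  then show ?thesis
    using nested_choices_subset_level[OF assms, of "Suc k"] by (simp add: subset_up_iff)
qed

text \<open>With the even terms fixed, the chain conditions at indices \<open>2 * k\<close> and
  \<open>2 * k + 1\<close> involve just one unknown, the term at \<open>2 * k + 1\<close>, bounding
  it by \<open>U k\<close> and \<open>L k\<close> respectively. The fibre is thus a product of
  intervals.\<close>

lemma card_even_levels_fibre:
  assumes N: "finite N" and \<chi>: "\<chi> \<in> nested_choices N \<alpha> \<beta> l"
  shows "real (card {E \<in> level_chains N \<alpha> \<beta> l. (\<lambda>k. E (2 * k)) = \<chi>})
           = 2 powi (alt_exponent N \<alpha> \<beta> l \<chi>)"
proof -
  define U where "U k = up N \<alpha> \<beta> (l + 2 * k) (\<chi> k)" for k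
  define L where "L k = down N \<alpha> \<beta> (l + 2 * Suc k) (\<chi> (Suc k))" for k
  define F where "F k = {C. L k \<subseteq> C \<and> C \<subseteq> U k}" for k
  have LU: "L k \<subseteq> U k" for k
    unfolding L_def U_def by (rule down_subset_up[OF \<chi>])
  have Ulev: "U k \<subseteq> level N \<alpha> \<beta> (Suc (l + 2 * k))" for k
    unfolding U_def by (rule up_subset_level)
  then have finU: "finite (U k)" for k
    using finite_level[OF N] finite_subset by blast
  \<comment> \<open>\<open>U k\<close> sits at level \<open>l + 2 * k + 1\<close>, which is beyond
    \<open>card N\<close>. From here on the interval \<open>F k\<close> is the single choice
    \<open>{}\<close> and the exponent receives nothing.\<close>
  have Uempty: "U k = {}" if "k \<ge> card N" for k
    using Ulev[of k] level_eq_empty[OF N, of "Suc (l + 2 * k)"] that by simp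
  have Lempty: "L k = {}" if "k \<ge> card N" for k
    using Uempty[OF that] LU[of k] by simp
  have bij: "bij_betw (\<lambda>E k. E (Suc (2 * k)))
      {E \<in> level_chains N \<alpha> \<beta> l. (\<lambda>k. E (2 * k)) = \<chi>} {f. \<forall>k. f k \<in> F k}"
  \<comment> \<open>The inverse interleaves the prescribed even terms with the chosen odd
    ones.\<close>
  proof (rule bij_betwI[where g = "\<lambda>f i. if even i then \<chi> (i div 2) else f (i div 2)"])
    show "(\<lambda>E k. E (Suc (2 * k))) \<in> {E \<in> level_chains N \<alpha> \<beta> l. (\<lambda>k. E (2 * k)) = \<chi>}
            \<rightarrow> {f. \<forall>k. f k \<in> F k}"
    proof
      fix E assume "E \<in> {E \<in> level_chains N \<alpha> \<beta> l. (\<lambda>k. E (2 * k)) = \<chi>}"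
      then have E: "E \<in> level_chains N \<alpha> \<beta> l" and even: "E (2 * k) = \<chi> k" for k
        by auto
      have step: "E (Suc i) \<subseteq> up N \<alpha> \<beta> (l + i) (E i)" for i
        using E by (simp add: level_chains_def)
      have "L k \<subseteq> E (Suc (2 * k))" for k
        using step[of "Suc (2 * k)"] level_chains_subset_level[OF E, of "2 * Suc k"] even[of "Suc k"]
        by (simp add: L_def subset_up_iff)
      moreover have "E (Suc (2 * k)) \<subseteq> U k" for k
        using step[of "2 * k"] even[of k] by (simp add: U_def)
      ultimately show "(\<lambda>k. E (Suc (2 * k))) \<in> {f. \<forall>k. f k \<in> F k}"
        by (simp add: F_def)
    qed
    show "(\<lambda>f i. if even i then \<chi> (i div 2) else f (i div 2)) \<in> {f. \<forall>k. f k \<in> F k}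
            \<rightarrow> {E \<in> level_chains N \<alpha> \<beta> l. (\<lambda>k. E (2 * k)) = \<chi>}"
    proof
      fix f assume "f \<in> {f. \<forall>k. f k \<in> F k}"
      then have f: "L k \<subseteq> f k" "f k \<subseteq> U k" for k
        by (auto simp: F_def)
      define E where "E i = (if even i then \<chi> (i div 2) else f (i div 2))" for i
      have "E (Suc i) \<subseteq> up N \<alpha> \<beta> (l + i) (E i)" for i
      proof (cases "even i")
        case True
        then obtain k where "i = 2 * k" by blast
        then show ?thesis using f(2)[of k] by (simp add: E_def U_def)
      next
        case False
        then obtain k where i: "i = Suc (2 * k)" by (auto elim: oddE)
        have "\<chi> (Suc k) \<subseteq> up N \<alpha> \<beta> (Suc (l + 2 * k)) (f k)"
          using f(1)[of k] nested_choices_subset_level[OF \<chi>, of "Suc k"]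
          by (subst subset_up_iff) (simp_all add: L_def)
        then show ?thesis by (simp add: E_def i)
      qed
      moreover have "E 0 \<subseteq> level N \<alpha> \<beta> l"
        using \<chi> by (simp add: E_def nested_choices_def)
      ultimately show "(\<lambda>i. if even i then \<chi> (i div 2) else f (i div 2))
          \<in> {E \<in> level_chains N \<alpha> \<beta> l. (\<lambda>k. E (2 * k)) = \<chi>}"
        by (simp add: level_chains_def flip: E_def) (simp add: E_def)
    qed
    show "(\<lambda>i. if even i then \<chi> (i div 2) else E (Suc (2 * (i div 2)))) = E"
      if "E \<in> {E \<in> level_chains N \<alpha> \<beta> l. (\<lambda>k. E (2 * k)) = \<chi>}" for E
      using that by (auto simp: fun_eq_iff)
  qed auto
  have "card {f. \<forall>k. f k \<in> F k} = (\<Prod>k<card N. card (F k))"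
  proof (rule card_choice_funs)
    show "finite (F k)" for k
      unfolding F_def by (rule finite_subset[of _ "Pow (U k)"]) (use finU in auto)
    show "F k = {{}}" if "card N \<le> k" for k
      by (simp add: F_def Uempty[OF that] Lempty[OF that])
  qed
  also have "\<dots> = (\<Prod>k<card N. 2 ^ (card (U k) - card (L k)))"
    using card_subset_interval[OF finU LU] by (simp add: F_def)
  also have "\<dots> = 2 ^ (\<Sum>k<card N. card (U k) - card (L k))"
    by (simp add: power_sum)
  finally have "card {E \<in> level_chains N \<alpha> \<beta> l. (\<lambda>k. E (2 * k)) = \<chi>}
      = 2 ^ (\<Sum>k<card N. card (U k) - card (L k))"
    using bij_betw_same_card[OF bij] by simp
  \<comment> \<open>The series has no nonzero term from \<open>card N\<close> on, and
    \<open>L k \<subseteq> U k\<close> makes natural and integer subtraction agree.\<close>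
  moreover have "alt_exponent N \<alpha> \<beta> l \<chi> = int (\<Sum>k<card N. card (U k) - card (L k))"
  proof -
    have "alt_exponent N \<alpha> \<beta> l \<chi> = (\<Sum>k. int (card (U k)) - int (card (L k)))"
      by (simp only: alt_exponent_def U_def L_def)
    also have "\<dots> = (\<Sum>k<card N. int (card (U k)) - int (card (L k)))"
      by (intro suminf_finite) (simp_all add: Uempty Lempty)
    also have "\<dots> = (\<Sum>k<card N. int (card (U k) - card (L k)))"
      using card_mono[OF finU LU] by (intro sum.cong) (auto simp: of_nat_diff)
    finally show ?thesis by simp
  qed
  ultimately show ?thesis
    by (simp only: power_int_of_nat of_nat_power of_nat_numeral)
qed

text \<open>Chains are grouped by their even terms; the weight is constant on each group since the
  bottom term is itself an even one. Weight \<open>1\<close> serves the first formula, while a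
  general \<open>w\<close> leaves room for a level below the bottom one.\<close>

lemma sum_level_chains:
  fixes w :: "'a set set \<Rightarrow> real"
  assumes "finite N"
  shows "(\<Sum>E\<in>level_chains N \<alpha> \<beta> l. w (E 0))
           = (\<Sum>\<chi>\<in>nested_choices N \<alpha> \<beta> l. w (\<chi> 0) * 2 powi (alt_exponent N \<alpha> \<beta> l \<chi>))"
proof -
  have "(\<Sum>E\<in>level_chains N \<alpha> \<beta> l. w (E 0))
      = (\<Sum>\<chi>\<in>nested_choices N \<alpha> \<beta> l. \<Sum>E | E \<in> level_chains N \<alpha> \<beta> l \<and> (\<lambda>k. E (2 * k)) = \<chi>. w (E 0))"
    by (rule sum.group[symmetric])
       (use assms in \<open>auto simp: finite_level_chains finite_nested_choices even_levels_nested_choices\<close>)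
  also have "\<dots> = (\<Sum>\<chi>\<in>nested_choices N \<alpha> \<beta> l.
      \<Sum>E | E \<in> level_chains N \<alpha> \<beta> l \<and> (\<lambda>k. E (2 * k)) = \<chi>. w (\<chi> 0))"
    by (intro sum.cong refl) auto
  also have "\<dots> = (\<Sum>\<chi>\<in>nested_choices N \<alpha> \<beta> l. w (\<chi> 0) * 2 powi (alt_exponent N \<alpha> \<beta> l \<chi>))"
    using card_even_levels_fibre[OF assms] by (intro sum.cong refl) simp
  finally show ?thesis .
qed

section \<open>Splitting off the bottom level\<close>

text \<open>Nothing lies beneath the first term of a chain, so its upper bound is the whole level,
  and its only other constraint is the lower bound \<open>down\<close> coming from the next term.
  The remaining terms form a chain starting one level higher.\<close>

lemma card_level_chains_shift:
  assumes N: "finite N"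
  shows "card (level_chains N \<alpha> \<beta> l)
           = (\<Sum>E\<in>level_chains N \<alpha> \<beta> (Suc l).
                2 ^ (card (level N \<alpha> \<beta> l) - card (down N \<alpha> \<beta> (Suc l) (E 0))))"
proof -
  define F where "F E = {C. down N \<alpha> \<beta> (Suc l) (E 0) \<subseteq> C \<and> C \<subseteq> level N \<alpha> \<beta> l}"
    for E :: "nat \<Rightarrow> 'a set set"
  have bij: "bij_betw (\<lambda>E. (\<lambda>i. E (Suc i), E 0)) (level_chains N \<alpha> \<beta> l)
      (SIGMA E:level_chains N \<alpha> \<beta> (Suc l). F E)"
  \<comment> \<open>\<open>case_nat C E\<close> is the sequence \<open>E\<close> with
    \<open>C\<close> put in front.\<close>
  proof (rule bij_betwI[where g = "\<lambda>(E, C). case_nat C E"])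
    show "(\<lambda>E. (\<lambda>i. E (Suc i), E 0)) \<in> level_chains N \<alpha> \<beta> l
        \<rightarrow> (SIGMA E:level_chains N \<alpha> \<beta> (Suc l). F E)"
    proof
      fix E assume E: "E \<in> level_chains N \<alpha> \<beta> l"
      have lev1: "E (Suc 0) \<subseteq> level N \<alpha> \<beta> (Suc l)"
        using level_chains_subset_level[OF E, of "Suc 0"] by simp
      have step: "E (Suc i) \<subseteq> up N \<alpha> \<beta> (l + i) (E i)" for i
        using E by (simp add: level_chains_def)
      have "E 0 \<in> F (\<lambda>i. E (Suc i))"
        using E step[of 0] lev1 by (simp add: F_def level_chains_def subset_up_iff)
      moreover have "E (Suc (Suc i)) \<subseteq> up N \<alpha> \<beta> (Suc l + i) (E (Suc i))" for i
        using step[of "Suc i"] by simp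
      ultimately show "(\<lambda>i. E (Suc i), E 0) \<in> (SIGMA E:level_chains N \<alpha> \<beta> (Suc l). F E)"
        using lev1 by (simp add: level_chains_def)
    qed
    show "(\<lambda>(E, C). case_nat C E) \<in> (SIGMA E:level_chains N \<alpha> \<beta> (Suc l). F E)
        \<rightarrow> level_chains N \<alpha> \<beta> l"
    proof clarify
      fix E C assume E: "E \<in> level_chains N \<alpha> \<beta> (Suc l)" and C: "C \<in> F E"
      have "case_nat C E (Suc i) \<subseteq> up N \<alpha> \<beta> (l + i) (case_nat C E i)" for i
      proof (cases i)
        case 0
        then show ?thesis
          using C E by (simp add: F_def level_chains_def subset_up_iff)
      next
        case (Suc j)
        then show ?thesis using E by (simp add: level_chains_def)
      qed
      then show "case_nat C E \<in> level_chains N \<alpha> \<beta> l"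
        using C by (simp add: level_chains_def F_def)
    qed
  qed (auto simp: fun_eq_iff split: nat.split)
  have "finite (F E)" for E
    unfolding F_def
    by (rule finite_subset[of _ "Pow (level N \<alpha> \<beta> l)"]) (use finite_level[OF N] in auto)
  then have "card (level_chains N \<alpha> \<beta> l) = (\<Sum>E\<in>level_chains N \<alpha> \<beta> (Suc l). card (F E))"
    using bij_betw_same_card[OF bij] finite_level_chains[OF N] by (simp add: card_SigmaI)
  moreover have "card (F E) = 2 ^ (card (level N \<alpha> \<beta> l) - card (down N \<alpha> \<beta> (Suc l) (E 0)))" for E
    unfolding F_def by (rule card_subset_interval[OF finite_level[OF N] down_subset_level])
  ultimately show ?thesis by simp
qed

section \<open>The even and the odd formula for the size of the interval\<close>

theorem theorem6p2:
  fixes N :: "'a set" and \<alpha> \<beta> :: "'a set set" and l0 :: nat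
  assumes "finite N"
    and "\<alpha> \<in> antichains N" and "\<beta> \<in> antichains N" and "ac_le \<alpha> \<beta>"
    and "ac_poset N \<alpha> \<beta> \<noteq> {} \<Longrightarrow> l0 = Min (card ` ac_poset N \<alpha> \<beta>)"
  shows "real (card (ac_interval N \<alpha> \<beta>)) =
           (\<Sum>\<chi> \<in> nested_choices N \<alpha> \<beta> l0. 2 powi (alt_exponent N \<alpha> \<beta> l0 \<chi>))
       \<and> real (card (ac_interval N \<alpha> \<beta>)) =
           (\<Sum>\<chi> \<in> nested_choices N \<alpha> \<beta> (l0 + 1).
              2 powi (int (card (level N \<alpha> \<beta> l0))
                      - int (card (down N \<alpha> \<beta> (l0 + 1) (\<chi> 0)))
                      + alt_exponent N \<alpha> \<beta> (l0 + 1) \<chi>))"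
proof -
  have "ac_poset N \<alpha> \<beta> \<subseteq> Pow N"
    by (auto simp: ac_poset_def)
  then have "finite (ac_poset N \<alpha> \<beta>)"
    by (rule finite_subset) (simp add: assms(1))
  then have "l0 \<le> card X" if "X \<in> ac_poset N \<alpha> \<beta>" for X
    \<comment> \<open>A given \<open>X\<close> witnesses that the poset is nonempty, so
      \<open>l0\<close> is the minimum; for an empty poset the bound is vacuous and
      \<open>l0\<close> may be arbitrary.\<close>
    using assms(5) that by (subst assms(5)) auto
  then have eq: "card (ac_interval N \<alpha> \<beta>) = card (level_chains N \<alpha> \<beta> l0)"
    using card_ac_interval_eq_lower_sets[OF assms(1-4)]
      card_lower_sets_eq_level_chains[OF assms(1,2,4)] by simp
  \<comment> \<open>The weight counts the choices for level \<open>l0\<close> once level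
    \<open>l0 + 1\<close> is known. Its integer exponent is the head of the second formula's
    exponent, which \<open>power_int_add\<close> later merges with the rest.\<close>
  define w :: "'a set set \<Rightarrow> real"
    where "w \<chi> = 2 powi (int (card (level N \<alpha> \<beta> l0)) - int (card (down N \<alpha> \<beta> (Suc l0) \<chi>)))" for \<chi>
  have w: "w \<chi> = 2 ^ (card (level N \<alpha> \<beta> l0) - card (down N \<alpha> \<beta> (Suc l0) \<chi>))" for \<chi>
    using card_mono[OF finite_level[OF assms(1)] down_subset_level[of N \<alpha> \<beta> l0 \<chi>]]
    by (simp add: w_def power_int_def nat_diff_distrib)
  have "real (card (level_chains N \<alpha> \<beta> l0)) = (\<Sum>E\<in>level_chains N \<alpha> \<beta> (Suc l0). w (E 0))"
    by (simp add: card_level_chains_shift[OF assms(1)] w)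
  also have "\<dots> = (\<Sum>\<chi>\<in>nested_choices N \<alpha> \<beta> (Suc l0).
      w (\<chi> 0) * 2 powi (alt_exponent N \<alpha> \<beta> (Suc l0) \<chi>))"
    by (rule sum_level_chains[OF assms(1)])
  finally show ?thesis
    using sum_level_chains[OF assms(1), of "\<lambda>_. 1" \<alpha> \<beta> l0]
    by (simp add: eq w_def power_int_add)
qed

end
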